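(* For every constant $k$, there is an algorithm that solves $\mathrm{NonExp}_{\infty}(\varepsilon,k)$ in time $O(\log^{\lceil k/2\rceil}(1/\varepsilon))$.
   Context: Let $\|\cdot\|_\infty$ be the $\ell_\infty$-norm on $\mathbb{R}^k$. A map $f:[0,1]^k\to[0,1]^k$ is nonexpansive with respect to $\|\cdot\|_\infty$ if $\|f(x)-f(y)\|_\infty\le\|x-y\|_\infty$ for all $x,y\in[0,1]^k$. In the problem $\mathrm{NonExp}_{\infty}(\varepsilon,k)$ (with $\varepsilon\in(0,1]$), an algorithm is given $\varepsilon$ and $k$ and black-box oracle access to an unknown nonexpansive map $f:[0,1]^k\to[0,1]^k$ with respect to $\|\cdot\|_\infty$: in each round it may send a point $x\in[0,1]^k$ to the oracle and receive $f(x)$. The goal is to output an $\varepsilon$-fixed point, i.e. a point $x\in[0,1]^k$ with $\|f(x)-x\|_\infty\le\varepsilon$. Running time counts total computation, with each oracle query costing one time step; the bound is worst case over all such $f$. *)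

theory Defs
  imports Complex_Main "HOL-Library.FuncSet" "HOL-Library.Landau_Symbols"
begin

text \<open>
  Vectors in dimension k are functions on the indices 0, ..., k - 1, made canonical by being
  undefined (in the sense of extensional functions) on all other indices.
\<close>

type_synonym vec = "nat \<Rightarrow> real"

definition cube :: "nat \<Rightarrow> vec set" where
  "cube k = {..<k} \<rightarrow>\<^sub>E {0..1}"

text \<open>Only meaningful for positive k.\<close>

definition linf_norm :: "nat \<Rightarrow> vec \<Rightarrow> real" where
  "linf_norm k v = Max ((\<lambda>i. \<bar>v i\<bar>) ` {..<k})"

definition nonexpansive :: "nat \<Rightarrow> (vec \<Rightarrow> vec) \<Rightarrow> bool" where
  "nonexpansive k f \<longleftrightarrow>
     f \<in> cube k \<rightarrow> cube k \<and>
     (\<forall>x\<in>cube k. \<forall>y\<in>cube k.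
        linf_norm k (\<lambda>i. f x i - f y i) \<le> linf_norm k (\<lambda>i. x i - y i))"

definition eps_fixed_point :: "nat \<Rightarrow> real \<Rightarrow> (vec \<Rightarrow> vec) \<Rightarrow> vec \<Rightarrow> bool" where
  "eps_fixed_point k \<epsilon> f x \<longleftrightarrow>
     x \<in> cube k \<and> linf_norm k (\<lambda>i. f x i - x i) \<le> \<epsilon>"

text \<open>
  Algorithms are structured programs for a real RAM with an oracle. The machine has a memory of
  natural numbers (counters and addresses) and a memory of exact real numbers. Every node of an
  evaluated expression, every store, every test of a conditional or loop and every oracle query
  costs one time step. Natural numbers support only addition and truncated subtraction; there is
  no conversion from reals to naturals (in particular no rounding), and only rational constants
  may occur in a program. Addresses are arbitrary expressions, which gives indirect addressing.
\<close>

datatype nexp =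
    NConst nat
  | NCell nexp
  | NAdd nexp nexp
  | NSub nexp nexp

datatype rexp =
    RConst rat
  | RCell nexp
  | ROfNat nexp
  | RAdd rexp rexp
  | RSub rexp rexp
  | RMul rexp rexp
  | RDiv rexp rexp

datatype bexp =
    NLess nexp nexp
  | RLess rexp rexp
  | BNot bexp
  | BAnd bexp bexp

datatype com =
    Skip
  | NStore nexp nexp
  | RStore nexp rexp
  | Query nexp nexp
  | Seq com com
  | Cond bexp com com
  | While bexp com

type_synonym state = "(nat \<Rightarrow> nat) \<times> (nat \<Rightarrow> real)"

primrec nval :: "state \<Rightarrow> nexp \<Rightarrow> nat" where
  "nval s (NConst n) = n"
| "nval s (NCell a) = fst s (nval s a)"
| "nval s (NAdd a b) = nval s a + nval s b"
| "nval s (NSub a b) = nval s a - nval s b"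

primrec rval :: "state \<Rightarrow> rexp \<Rightarrow> real" where
  "rval s (RConst q) = of_rat q"
| "rval s (RCell a) = snd s (nval s a)"
| "rval s (ROfNat a) = real (nval s a)"
| "rval s (RAdd a b) = rval s a + rval s b"
| "rval s (RSub a b) = rval s a - rval s b"
| "rval s (RMul a b) = rval s a * rval s b"
| "rval s (RDiv a b) = rval s a / rval s b"

primrec bval :: "state \<Rightarrow> bexp \<Rightarrow> bool" where
  "bval s (NLess a b) \<longleftrightarrow> nval s a < nval s b"
| "bval s (RLess a b) \<longleftrightarrow> rval s a < rval s b"
| "bval s (BNot b) \<longleftrightarrow> \<not> bval s b"
| "bval s (BAnd b c) \<longleftrightarrow> bval s b \<and> bval s c"

primrec ncost :: "nexp \<Rightarrow> nat" where
  "ncost (NConst n) = 1"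
| "ncost (NCell a) = 1 + ncost a"
| "ncost (NAdd a b) = 1 + ncost a + ncost b"
| "ncost (NSub a b) = 1 + ncost a + ncost b"

primrec rcost :: "rexp \<Rightarrow> nat" where
  "rcost (RConst q) = 1"
| "rcost (RCell a) = 1 + ncost a"
| "rcost (ROfNat a) = 1 + ncost a"
| "rcost (RAdd a b) = 1 + rcost a + rcost b"
| "rcost (RSub a b) = 1 + rcost a + rcost b"
| "rcost (RMul a b) = 1 + rcost a + rcost b"
| "rcost (RDiv a b) = 1 + rcost a + rcost b"

primrec bcost :: "bexp \<Rightarrow> nat" where
  "bcost (NLess a b) = 1 + ncost a + ncost b"
| "bcost (RLess a b) = 1 + rcost a + rcost b"
| "bcost (BNot b) = 1 + bcost b"
| "bcost (BAnd b c) = 1 + bcost b + bcost c"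

definition read_vec :: "nat \<Rightarrow> (nat \<Rightarrow> real) \<Rightarrow> nat \<Rightarrow> vec" where
  "read_vec k m a = (\<lambda>i\<in>{..<k}. m (a + i))"

definition write_vec :: "nat \<Rightarrow> nat \<Rightarrow> vec \<Rightarrow> (nat \<Rightarrow> real) \<Rightarrow> (nat \<Rightarrow> real)" where
  "write_vec k a v m = (\<lambda>j. if a \<le> j \<and> j < a + k then v (j - a) else m j)"

text \<open>
  \<open>exec k f c s t s'\<close>: started in state s with oracle f, the program c halts after exactly t
  steps in state s'. A query outside the cube has no successor, so a program that issues one does
  not halt in this sense.
\<close>

inductive exec :: "nat \<Rightarrow> (vec \<Rightarrow> vec) \<Rightarrow> com \<Rightarrow> state \<Rightarrow> nat \<Rightarrow> state \<Rightarrow> bool"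
  for k :: nat and f :: "vec \<Rightarrow> vec"
where
  Skip: "exec k f Skip s 1 s"
| NStore: "exec k f (NStore a e) s (1 + ncost a + ncost e)
             ((fst s)(nval s a := nval s e), snd s)"
| RStore: "exec k f (RStore a e) s (1 + ncost a + rcost e)
             (fst s, (snd s)(nval s a := rval s e))"
| Query: "read_vec k (snd s) (nval s a) \<in> cube k \<Longrightarrow>
            exec k f (Query a b) s (1 + ncost a + ncost b)
              (fst s, write_vec k (nval s b) (f (read_vec k (snd s) (nval s a))) (snd s))"
| Seq: "exec k f c s t s' \<Longrightarrow> exec k f d s' u s'' \<Longrightarrow> exec k f (Seq c d) s (t + u) s''"
| CondTrue: "bval s b \<Longrightarrow> exec k f c s t s' \<Longrightarrow> exec k f (Cond b c d) s (1 + bcost b + t) s'"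
| CondFalse: "\<not> bval s b \<Longrightarrow> exec k f d s t s' \<Longrightarrow> exec k f (Cond b c d) s (1 + bcost b + t) s'"
| WhileFalse: "\<not> bval s b \<Longrightarrow> exec k f (While b c) s (1 + bcost b) s"
| WhileTrue: "bval s b \<Longrightarrow> exec k f c s t s' \<Longrightarrow> exec k f (While b c) s' u s'' \<Longrightarrow>
                exec k f (While b c) s (1 + bcost b + t + u) s''"

lemma exec_deterministic:
  "exec k f c s t s' \<Longrightarrow> exec k f c s u s'' \<Longrightarrow> u = t \<and> s'' = s'"
proof (induction arbitrary: u s'' rule: exec.induct)
  case (Skip s)
  from Skip.prems show ?case by cases auto
next
  case (NStore a e s)
  from NStore.prems show ?case by cases auto
next
  case (RStore a e s)
  from RStore.prems show ?case by cases auto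
next
  case (Query s a b)
  from Query.prems show ?case by cases auto
next
  case (Seq c s t s' d v r)
  note IH = Seq.IH
  from Seq.prems show ?case
  proof cases
    case (Seq t1 s1 u1)
    have "t1 = t \<and> s1 = s'" using IH(1) Seq(2) .
    moreover from this have "u1 = v \<and> s'' = r" using IH(2) Seq(3) by simp
    ultimately show ?thesis using Seq(1) by simp
  qed
next
  case (CondTrue s b c t s' d)
  from CondTrue.prems show ?case by cases (use CondTrue.hyps in \<open>auto dest!: CondTrue.IH\<close>)
next
  case (CondFalse s b d t s' c)
  from CondFalse.prems show ?case by cases (use CondFalse.hyps in \<open>auto dest!: CondFalse.IH\<close>)
next
  case (WhileFalse s b c)
  from WhileFalse.prems show ?case by cases (use WhileFalse.hyps in auto)
next
  case (WhileTrue s b c t s' v r)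
  note hyp = WhileTrue.hyps(1) and IH = WhileTrue.IH
  from WhileTrue.prems show ?case
  proof cases
    case WhileFalse
    with hyp show ?thesis by simp
  next
    case (WhileTrue t1 s1 u1)
    have "t1 = t \<and> s1 = s'" using IH(1) WhileTrue(3) .
    moreover from this have "u1 = v \<and> s'' = r" using IH(2) WhileTrue(4) by simp
    ultimately show ?thesis using WhileTrue(1) by simp
  qed
qed

text \<open>
  Input: k in natural cell 0 and the accuracy in real cell 0, everything else zero.
  Output: the real cells 0, ..., k - 1.
\<close>

definition init_state :: "nat \<Rightarrow> real \<Rightarrow> state" where
  "init_state k \<epsilon> = ((\<lambda>_. 0)(0 := k), (\<lambda>_. 0)(0 := \<epsilon>))"

definition result_vec :: "nat \<Rightarrow> state \<Rightarrow> vec" where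
  "result_vec k s = read_vec k (snd s) 0"

definition solves_NonExp_in_time :: "nat \<Rightarrow> com \<Rightarrow> (real \<Rightarrow> nat) \<Rightarrow> bool" where
  "solves_NonExp_in_time k P T \<longleftrightarrow>
     (\<forall>\<epsilon>\<in>{0<..1}. \<forall>f. nonexpansive k f \<longrightarrow>
        (\<exists>t s. exec k f P (init_state k \<epsilon>) t s \<and> t \<le> T \<epsilon> \<and>
               eps_fixed_point k \<epsilon> f (result_vec k s)))"

end

theory Submission
  imports Defs
begin

text \<open>
  Replace f by the contraction \<open>(1 - \<epsilon> / 2) f\<close> and search for the coordinates two at a time. For given
  values of the two outermost coordinates a and b, a recursive call makes all inner coordinates
  almost fixed, with a much smaller tolerance. Let z be the vector from the current point to a
  fixed point and D the displacement of the current point. Contraction forces the largest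
  coordinate of z to be one of a and b, and to have the sign of the corresponding entry of D, unless
  D is already small. Hence the signs of \<open>D\<^sub>a\<close> and \<open>D\<^sub>b\<close> exclude a half-plane bounded by a diagonal
  line through the current point, so querying the centre of a rectangle in the coordinates
  \<open>u = x\<^sub>a + x\<^sub>b\<close> and \<open>v = x\<^sub>a - x\<^sub>b\<close> halves one of its sides. If one side is already tiny, the
  entry of D above the tolerance decides how to halve the other one. So every pair of coordinates
  costs a factor of \<open>O(log (1 / \<epsilon>))\<close>.
\<close>

section \<open>Programs\<close>

primrec straight :: "com \<Rightarrow> bool" where
  "straight Skip = True"
| "straight (NStore a e) = True"
| "straight (RStore a e) = True"
| "straight (Query a b) = False"
| "straight (Seq c d) = (straight c \<and> straight d)"
| "straight (Cond b c d) = (straight c \<and> straight d)"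
| "straight (While b c) = False"

primrec run :: "com \<Rightarrow> state \<Rightarrow> state" where
  "run Skip s = s"
| "run (NStore a e) s = ((fst s)(nval s a := nval s e), snd s)"
| "run (RStore a e) s = (fst s, (snd s)(nval s a := rval s e))"
| "run (Query a b) s = s"
| "run (Seq c d) s = run d (run c s)"
| "run (Cond b c d) s = (if bval s b then run c s else run d s)"
| "run (While b c) s = s"

text \<open>A bound independent of the state, so both branches of a conditional are added. The
  values for \<open>Query\<close> and \<open>While\<close> are placeholders; \<open>straight\<close>
  excludes both.\<close>

primrec wcost :: "com \<Rightarrow> nat" where
  "wcost Skip = 1"
| "wcost (NStore a e) = 1 + ncost a + ncost e"
| "wcost (RStore a e) = 1 + ncost a + rcost e"
| "wcost (Query a b) = 0"
| "wcost (Seq c d) = wcost c + wcost d"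
| "wcost (Cond b c d) = 1 + bcost b + wcost c + wcost d"
| "wcost (While b c) = 0"

lemma exec_straight:
  "straight c \<Longrightarrow> \<exists>t\<le>wcost c. exec k f c s t (run c s)"
proof (induction c arbitrary: s)
  case (Seq c d)
  obtain t u where "t \<le> wcost c" "exec k f c s t (run c s)"
    "u \<le> wcost d" "exec k f d (run c s) u (run d (run c s))"
    using Seq.IH(1)[of s] Seq.IH(2)[of "run c s"] Seq.prems by auto
  then show ?case using exec.Seq[of k f c s t "run c s" d u]
    by (intro exI[of _ "t + u"]) auto
next
  case (Cond b c d)
  show ?case
  proof (cases "bval s b")
    case True
    obtain t where "t \<le> wcost c" "exec k f c s t (run c s)"
      using Cond.IH(1)[of s] Cond.prems by auto
    with True show ?thesis using exec.CondTrue[of s b k f c t "run c s" d]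
      by (intro exI[of _ "1 + bcost b + t"]) auto
  next
    case False
    obtain t where "t \<le> wcost d" "exec k f d s t (run d s)"
      using Cond.IH(2)[of s] Cond.prems by auto
    with False show ?thesis using exec.CondFalse[of s b k f d t "run d s" c]
      by (intro exI[of _ "1 + bcost b + t"]) auto
  qed
next
  case Skip
  show ?case using exec.Skip[of k f s] by auto
next
  case (NStore a e)
  show ?case using exec.NStore[of k f a e s] by auto
next
  case (RStore a e)
  show ?case using exec.RStore[of k f a e s] by auto
qed auto

text \<open>The index \<open>n\<close> is a potential: each iteration lowers it by one, so the body
  runs at most \<open>n\<close> times and the test once more. This yields termination together with
  the time bound.\<close>

lemma exec_while_bound:
  assumes step: "\<And>n s. I n s \<Longrightarrow> bval s b \<Longrightarrow>
      \<exists>n' t s'. n = Suc n' \<and> exec k f c s t s' \<and> t \<le> B \<and> I n' s'"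
    and "I n s"
  shows "\<exists>t s' n'. exec k f (While b c) s t s' \<and> t \<le> Suc n * (1 + bcost b + B)
           \<and> \<not> bval s' b \<and> I n' s'"
  using assms(2)
proof (induction n arbitrary: s rule: less_induct)
  case (less n)
  show ?case
  proof (cases "bval s b")
    case False
    then show ?thesis
      using exec.WhileFalse[of s b k f c] less.prems
      by (intro exI[of _ "1 + bcost b"] exI[of _ s] exI[of _ n]) auto
  next
    case True
    obtain n' t s' where 1: "n = Suc n'" "exec k f c s t s'" "t \<le> B" "I n' s'"
      using step[OF less.prems True] by blast
    obtain u s'' n'' where 2: "exec k f (While b c) s' u s''"
      "u \<le> Suc n' * (1 + bcost b + B)" "\<not> bval s'' b" "I n'' s''"
      using less.IH[of n' s'] 1 by auto
    have "exec k f (While b c) s (1 + bcost b + t + u) s''"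
      using True 1(2) 2(1) by (rule exec.WhileTrue)
    moreover have "1 + bcost b + t + u \<le> Suc n * (1 + bcost b + B)"
      using 1 2(2) by simp
    ultimately show ?thesis using 2 by blast
  qed
qed

section \<open>The search program and its time bound\<close>

abbreviation cell :: "nat \<Rightarrow> rexp" where
  "cell a \<equiv> RCell (NConst a)"

abbreviation assign :: "nat \<Rightarrow> rexp \<Rightarrow> com" where
  "assign a e \<equiv> RStore (NConst a) e"

abbreviation bor :: "bexp \<Rightarrow> bexp \<Rightarrow> bexp" where
  "bor b c \<equiv> BNot (BAnd (BNot b) (BNot c))"

text \<open>
  Real memory: the current point in cells 0, ..., K - 1, its image in K, ..., 2 K - 1, the accuracy
  in 2 K, and four cells per level for the centre and the half-widths of the search region in the
  coordinates \<open>x\<^sub>a + x\<^sub>b\<close> and \<open>x\<^sub>a - x\<^sub>b\<close>. Here K is k rounded up to an even number; for odd k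
  the additional coordinate of the image is never written and stays zero.
\<close>

definition ucell :: "nat \<Rightarrow> nat \<Rightarrow> nat" where "ucell K j = 2 * K + 1 + 4 * j"
definition vcell :: "nat \<Rightarrow> nat \<Rightarrow> nat" where "vcell K j = 2 * K + 2 + 4 * j"
definition wucell :: "nat \<Rightarrow> nat \<Rightarrow> nat" where "wucell K j = 2 * K + 3 + 4 * j"
definition wvcell :: "nat \<Rightarrow> nat \<Rightarrow> nat" where "wvcell K j = 2 * K + 4 + 4 * j"

lemmas cell_defs = ucell_def vcell_def wucell_def wvcell_def

text \<open>The outermost tolerance leaves the other half of the accuracy for passing from the
  contraction back to \<open>f\<close>. The factor \<open>\<epsilon> / 8\<close> per level is
  \<open>\<eta> / 4\<close> for \<open>\<eta> = \<epsilon> / 2\<close>, the inner displacement that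
  \<open>max_coordinate\<close> tolerates.\<close>

primrec tol :: "nat \<Rightarrow> nat \<Rightarrow> rexp" where
  "tol K 0 = RDiv (cell (2 * K)) (RConst 2)"
| "tol K (Suc d) = RMul (tol K d) (RDiv (cell (2 * K)) (RConst 8))"

definition centre_a :: "nat \<Rightarrow> nat \<Rightarrow> rexp" where
  "centre_a K j = RDiv (RAdd (cell (ucell K j)) (cell (vcell K j))) (RConst 2)"

definition centre_b :: "nat \<Rightarrow> nat \<Rightarrow> rexp" where
  "centre_b K j = RDiv (RSub (cell (ucell K j)) (cell (vcell K j))) (RConst 2)"

definition scaled_image :: "nat \<Rightarrow> nat \<Rightarrow> rexp" where
  "scaled_image K i =
     RMul (RSub (RConst 1) (RDiv (cell (2 * K)) (RConst 2))) (cell (K + i))"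

text \<open>The displacement is measured from the unclamped centre of the rectangle, which may lie
  outside the unit square, although the query uses the clamped point.\<close>

definition disp_a :: "nat \<Rightarrow> nat \<Rightarrow> rexp" where
  "disp_a K j = RSub (scaled_image K (2 * j)) (centre_a K j)"

definition disp_b :: "nat \<Rightarrow> nat \<Rightarrow> rexp" where
  "disp_b K j = RSub (scaled_image K (2 * j + 1)) (centre_b K j)"

definition abs_gt :: "rexp \<Rightarrow> rexp \<Rightarrow> bexp" where
  "abs_gt x e = bor (RLess e x) (RLess e (RSub (RConst 0) x))"

definition clamp_to :: "nat \<Rightarrow> rexp \<Rightarrow> com" where
  "clamp_to a e = Cond (RLess e (RConst 0)) (assign a (RConst 0))
     (Cond (RLess (RConst 1) e) (assign a (RConst 1)) (assign a e))"

definition place :: "nat \<Rightarrow> nat \<Rightarrow> com" where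
  "place K j = Seq (clamp_to (2 * j) (centre_a K j)) (clamp_to (2 * j + 1) (centre_b K j))"

text \<open>On the unit square the sum of the coordinates ranges over [0, 2] and their difference
  over [-1, 1].\<close>

definition start :: "nat \<Rightarrow> nat \<Rightarrow> com" where
  "start K j =
     Seq (assign (ucell K j) (RConst 1)) (Seq (assign (vcell K j) (RConst 0))
     (Seq (assign (wucell K j) (RConst 1)) (Seq (assign (wvcell K j) (RConst 1)) (place K j))))"

definition raise :: "nat \<Rightarrow> nat \<Rightarrow> com" where
  "raise a w = Seq (assign w (RDiv (cell w) (RConst 2))) (assign a (RAdd (cell a) (cell w)))"

definition lower :: "nat \<Rightarrow> nat \<Rightarrow> com" where
  "lower a w = Seq (assign w (RDiv (cell w) (RConst 2))) (assign a (RSub (cell a) (cell w)))"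

text \<open>
  If the signs of the displacements agree, the u-side is halved, otherwise the v-side, except that
  a side of half-width at most a quarter of the tolerance is never halved.
\<close>

definition cut_u :: "nat \<Rightarrow> nat \<Rightarrow> nat \<Rightarrow> bexp" where
  "cut_u K j d = bor
     (BAnd (BNot (RLess (RMul (disp_a K j) (disp_b K j)) (RConst 0)))
           (RLess (RDiv (tol K d) (RConst 4)) (cell (wucell K j))))
     (BNot (RLess (RDiv (tol K d) (RConst 4)) (cell (wvcell K j))))"

text \<open>An entry above the tolerance gives the direction. The second coordinate enters
  \<open>v\<close> with a minus sign, hence the exchange of \<open>lower\<close> and
  \<open>raise\<close> at the end.\<close>

definition cut :: "nat \<Rightarrow> nat \<Rightarrow> nat \<Rightarrow> com" where
  "cut K j d =
     (let u = ucell K j; v = vcell K j; wu = wucell K j; wv = wvcell K j;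
          pos_a = RLess (RConst 0) (disp_a K j); pos_b = RLess (RConst 0) (disp_b K j) in
      Cond (abs_gt (disp_a K j) (tol K d))
        (Cond (cut_u K j d)
          (Cond pos_a (raise u wu) (lower u wu)) (Cond pos_a (raise v wv) (lower v wv)))
        (Cond (cut_u K j d)
          (Cond pos_b (raise u wu) (lower u wu)) (Cond pos_b (lower v wv) (raise v wv))))"

definition far :: "nat \<Rightarrow> nat \<Rightarrow> nat \<Rightarrow> bexp" where
  "far K j d = bor (abs_gt (disp_a K j) (tol K d)) (abs_gt (disp_b K j) (tol K d))"

text \<open>Here \<open>j\<close> is the number of inner coordinate pairs to solve and
  \<open>d\<close> the number of enclosing levels. There are no procedures, so recursion is unfolded
  into the program text, whose size depends on the dimension only.\<close>

primrec level :: "nat \<Rightarrow> nat \<Rightarrow> nat \<Rightarrow> com" where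
  "level K 0 d = Query (NConst 0) (NConst K)"
| "level K (Suc j) d =
     Seq (start K j) (Seq (level K j (Suc d))
       (While (far K j d) (Seq (cut K j d) (Seq (place K j) (level K j (Suc d))))))"

text \<open>\<open>R\<close> bounds the halvings of one side, so a loop makes at most
  \<open>2 * R\<close> cuts.\<close>

primrec level_time :: "nat \<Rightarrow> nat \<Rightarrow> nat \<Rightarrow> nat \<Rightarrow> nat" where
  "level_time K R 0 d = 3"
| "level_time K R (Suc j) d =
     wcost (start K j) + (level_time K R j (Suc d) +
       Suc (2 * R) * (1 + bcost (far K j d) +
         (wcost (cut K j d) + (wcost (place K j) + level_time K R j (Suc d)))))"

section \<open>Effect of the loop-free pieces\<close>

lemma straight_pieces: "straight (place K j)" "straight (start K j)" "straight (cut K j d)"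
  by (simp_all add: place_def start_def cut_def clamp_to_def raise_def lower_def Let_def)

definition tolv :: "real \<Rightarrow> nat \<Rightarrow> real" where
  "tolv \<epsilon> d = \<epsilon> / 2 * (\<epsilon> / 8) ^ d"

lemma rval_tol: "rval s (tol K d) = tolv (snd s (2 * K)) d"
  by (induction d) (simp_all add: tolv_def)

definition clamp01 :: "real \<Rightarrow> real" where
  "clamp01 x = (if x < 0 then 0 else if 1 < x then 1 else x)"

lemma clamp01_range: "0 \<le> clamp01 x" "clamp01 x \<le> 1"
  by (auto simp: clamp01_def)

lemma clamp01_closer: "0 \<le> y \<Longrightarrow> y \<le> 1 \<Longrightarrow> \<bar>y - clamp01 x\<bar> \<le> \<bar>y - x\<bar>"
  by (auto simp: clamp01_def)

lemma run_clamp_to: "run (clamp_to a e) s = (fst s, (snd s)(a := clamp01 (rval s e)))"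
  by (simp add: clamp_to_def clamp01_def)

lemma run_place:
  assumes "2 * j + 1 < K"
  shows "run (place K j) s = (fst s, (snd s)
    (2 * j := clamp01 ((snd s (ucell K j) + snd s (vcell K j)) / 2),
     2 * j + 1 := clamp01 ((snd s (ucell K j) - snd s (vcell K j)) / 2)))"
  using assms by (simp add: place_def run_clamp_to centre_a_def centre_b_def cell_defs)

lemma run_start:
  assumes "2 * j + 1 < K"
  shows "run (start K j) s = (fst s, (snd s)
    (ucell K j := 1, vcell K j := 0, wucell K j := 1, wvcell K j := 1,
     2 * j := clamp01 (1 / 2), 2 * j + 1 := clamp01 (1 / 2)))"
  using assms by (simp add: start_def run_place) (simp add: cell_defs)

lemma run_raise:
  "a \<noteq> w \<Longrightarrow> run (raise a w) s = (fst s, (snd s)(w := snd s w / 2, a := snd s a + snd s w / 2))"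
  by (simp add: raise_def)

lemma run_lower:
  "a \<noteq> w \<Longrightarrow> run (lower a w) s = (fst s, (snd s)(w := snd s w / 2, a := snd s a - snd s w / 2))"
  by (simp add: lower_def)

lemma bval_abs_gt: "bval s (abs_gt x e) \<longleftrightarrow> rval s e < \<bar>rval s x\<bar>"
  by (auto simp: abs_gt_def)

section \<open>The bisection step\<close>

text \<open>
  Here (x, y) leads to the fixed point and (p, q) is the displacement, \<open>M\<close> being the norm of the
  former over all coordinates.
\<close>

lemma half_plane_aux:
  fixes x y p q E M \<tau> :: real
  assumes "\<bar>x\<bar> \<le> M" "\<bar>y\<bar> \<le> M" "\<bar>x - p\<bar> \<le> M + \<tau>" "\<tau> \<le> E / 8" "0 < E"
    and "\<bar>x\<bar> = M \<and> 0 < p * x \<or> \<bar>y\<bar> = M \<and> 0 < q * y"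
    and "0 \<le> p * q \<or> \<bar>x - y\<bar> \<le> E / 4"
    and "E < \<bar>p\<bar>"
  shows "0 \<le> p * (x + y)"
  using assms(6)
proof
  assume "\<bar>x\<bar> = M \<and> 0 < p * x"
  then show ?thesis using assms(2) by (auto simp: zero_less_mult_iff zero_le_mult_iff)
next
  assume y: "\<bar>y\<bar> = M \<and> 0 < q * y"
  show ?thesis
  proof (cases "0 \<le> p * q")
    case True
    with y have "0 < p \<and> 0 < y \<or> p < 0 \<and> y < 0"
      using assms(5,8) by (auto simp: zero_less_mult_iff zero_le_mult_iff)
    then show ?thesis using y assms(1) by (auto simp: zero_le_mult_iff)
  next
    case False
    \<comment> \<open>This case is contradictory: \<open>x\<close> is within \<open>E / 4\<close> of
      \<open>y\<close>, which has modulus \<open>M\<close>, while \<open>p\<close> has the opposite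
      sign and modulus above \<open>E\<close>. So \<open>\<bar>x - p\<bar>\<close> exceeds
      \<open>M + 3 * E / 4\<close>, against the bound \<open>M + \<tau>\<close>.\<close>
    then have near: "\<bar>x - y\<bar> \<le> E / 4" using assms(7) by blast
    from False y have "p < 0 \<and> 0 < y \<or> 0 < p \<and> y < 0"
      by (auto simp: zero_less_mult_iff not_le mult_less_0_iff)
    then show ?thesis
    proof
      assume "p < 0 \<and> 0 < y"
      then show ?thesis using near y assms(3,4,5,8) by linarith
    next
      assume "0 < p \<and> y < 0"
      then show ?thesis using near y assms(3,4,5,8) by linarith
    qed
  qed
qed

text \<open>All four cases come from \<open>half_plane_aux\<close> by exchanging the axes and
  reflecting \<open>y\<close>. The first two justify cutting the sum, the last two cutting the
  difference.\<close>

lemma half_plane: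
  fixes x y p q E M \<tau> :: real
  assumes "\<bar>x\<bar> \<le> M" "\<bar>y\<bar> \<le> M" "\<bar>x - p\<bar> \<le> M + \<tau>" "\<bar>y - q\<bar> \<le> M + \<tau>" "\<tau> \<le> E / 8" "0 < E"
    and max: "\<bar>x\<bar> = M \<and> 0 < p * x \<or> \<bar>y\<bar> = M \<and> 0 < q * y"
  shows "0 \<le> p * q \<or> \<bar>x - y\<bar> \<le> E / 4 \<Longrightarrow> E < \<bar>p\<bar> \<Longrightarrow> 0 \<le> p * (x + y)"
    and "0 \<le> p * q \<or> \<bar>x - y\<bar> \<le> E / 4 \<Longrightarrow> E < \<bar>q\<bar> \<Longrightarrow> 0 \<le> q * (x + y)"
    and "p * q \<le> 0 \<or> \<bar>x + y\<bar> \<le> E / 4 \<Longrightarrow> E < \<bar>p\<bar> \<Longrightarrow> 0 \<le> p * (x - y)"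
    and "p * q \<le> 0 \<or> \<bar>x + y\<bar> \<le> E / 4 \<Longrightarrow> E < \<bar>q\<bar> \<Longrightarrow> q * (x - y) \<le> 0"
proof -
  show "0 \<le> p * q \<or> \<bar>x - y\<bar> \<le> E / 4 \<Longrightarrow> E < \<bar>p\<bar> \<Longrightarrow> 0 \<le> p * (x + y)"
    using half_plane_aux[of x M y p \<tau> E q] assms by blast
  show "0 \<le> p * q \<or> \<bar>x - y\<bar> \<le> E / 4 \<Longrightarrow> E < \<bar>q\<bar> \<Longrightarrow> 0 \<le> q * (x + y)"
    using half_plane_aux[of y M x q \<tau> E p] assms
    by (auto simp: abs_minus_commute add.commute mult.commute)
  show "p * q \<le> 0 \<or> \<bar>x + y\<bar> \<le> E / 4 \<Longrightarrow> E < \<bar>p\<bar> \<Longrightarrow> 0 \<le> p * (x - y)"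
    using half_plane_aux[of x M "- y" p \<tau> E "- q"] assms by auto
  have "\<bar>- y - - q\<bar> = \<bar>y - q\<bar>" "\<bar>- y - x\<bar> = \<bar>x + y\<bar>" by linarith+
  then show "p * q \<le> 0 \<or> \<bar>x + y\<bar> \<le> E / 4 \<Longrightarrow> E < \<bar>q\<bar> \<Longrightarrow> q * (x - y) \<le> 0"
    using half_plane_aux[of "- y" M x "- q" \<tau> E p] assms
    by (auto simp: algebra_simps)
qed

text \<open>At the maximal coordinate the contraction leaves a displacement of size at least
  \<open>\<eta> * M - \<tau>\<close> pointing along \<open>z\<close>. A displacement above
  \<open>E\<close> forces \<open>M\<close> above \<open>(E - \<tau>) / 2\<close>, so that this size
  exceeds \<open>\<eta> * E / 4\<close>, the bound for inner coordinates.\<close>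

lemma max_coordinate:
  fixes z d :: "nat \<Rightarrow> real"
  assumes \<eta>: "0 < \<eta>" "\<eta> \<le> 1" and E: "0 < E" and \<tau>: "0 \<le> \<tau>" "\<tau> \<le> \<eta> * E / 8"
    and M: "\<And>i. i < n + 2 \<Longrightarrow> \<bar>z i\<bar> \<le> M" "i0 < n + 2" "\<bar>z i0\<bar> = M"
    and zd: "\<And>i. i < n + 2 \<Longrightarrow> \<bar>z i - d i\<bar> \<le> (1 - \<eta>) * M + \<tau>"
    and small: "\<And>i. i < n \<Longrightarrow> \<bar>d i\<bar> \<le> \<eta> * E / 4"
    and big: "l < n + 2" "E < \<bar>d l\<bar>"
  shows "i0 = n \<or> i0 = n + 1" "0 < d i0 * z i0" "E - \<tau> < 2 * M"
proof -
  have Mpos: "0 \<le> M" using M(3) by linarith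
  have eM: "(1 - \<eta>) * M \<le> M" using Mpos \<eta> by (simp add: mult_left_le_one_le)
  show EM: "E - \<tau> < 2 * M" using zd[OF big(1)] M(1)[OF big(1)] big(2) eM by linarith
  have "\<eta> * (E - \<tau>) < \<eta> * (2 * M)" using EM \<eta> by simp
  moreover have "\<eta> * \<tau> \<le> \<tau>" using \<eta> \<tau> by (simp add: mult_left_le_one_le)
  ultimately have "\<eta> * E - \<tau> < 2 * (\<eta> * M)" by (simp add: algebra_simps)
  then have *: "\<eta> * E / 4 < \<eta> * M - \<tau>" using \<tau> \<eta> E mult_pos_pos[OF \<eta>(1) E] by linarith
  have zd0: "\<bar>z i0 - d i0\<bar> \<le> M - \<eta> * M + \<tau>" using zd[OF M(2)] by (simp add: algebra_simps)
  have **: "0 \<le> z i0 \<and> \<eta> * E / 4 < d i0 \<or> z i0 < 0 \<and> d i0 < - (\<eta> * E / 4)"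
    using zd0 * M(3) by linarith
  have pos: "0 < \<eta> * E" using \<eta> E by simp
  show "i0 = n \<or> i0 = n + 1"
  proof (rule ccontr)
    assume "\<not> ?thesis"
    then have "i0 < n" using M(2) by linarith
    from small[OF this] ** pos show False by linarith
  qed
  have "0 < M" using EM \<tau> mult_right_mono[OF \<eta>(2), of E] E by (simp, linarith)
  then have "0 < z i0 \<and> 0 < d i0 \<or> z i0 < 0 \<and> d i0 < 0" using ** M(3) pos by linarith
  then show "0 < d i0 * z i0" by (auto simp: zero_less_mult_iff)
qed

lemma halve_interval:
  fixes x c w :: real
  assumes "\<bar>x - c\<bar> \<le> w" "b \<Longrightarrow> c \<le> x" "\<not> b \<Longrightarrow> x \<le> c"
  shows "\<bar>x - (if b then c + w / 2 else c - w / 2)\<bar> \<le> w / 2"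
proof (cases b)
  case True
  then show ?thesis using assms(1) assms(2)[OF True] unfolding if_P[OF True] by linarith
next
  case False
  then show ?thesis using assms(1) assms(3)[OF False] unfolding if_not_P[OF False] by linarith
qed

text \<open>Merges the nested conditionals: \<open>su\<close> and \<open>sv\<close> record the
  direction, leaving one case per side.\<close>

lemma run_cut:
  assumes "s = (n, m)" "p = rval s (disp_a K j)" "q = rval s (disp_b K j)"
    "E = rval s (tol K d)" "su = (if E < \<bar>p\<bar> then 0 < p else 0 < q)"
    "sv = (if E < \<bar>p\<bar> then 0 < p else \<not> 0 < q)"
  shows "run (cut K j d) s = (n,
     if 0 \<le> p * q \<and> E / 4 < m (wucell K j) \<or> m (wvcell K j) \<le> E / 4
     then m(wucell K j := m (wucell K j) / 2,
            ucell K j := (if su then m (ucell K j) + m (wucell K j) / 2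
                          else m (ucell K j) - m (wucell K j) / 2))
     else m(wvcell K j := m (wvcell K j) / 2,
            vcell K j := (if sv then m (vcell K j) + m (wvcell K j) / 2
                          else m (vcell K j) - m (wvcell K j) / 2)))"
proof -
  have ne: "ucell K j \<noteq> wucell K j" "vcell K j \<noteq> wvcell K j" by (simp_all add: cell_defs)
  have cu: "bval s (cut_u K j d) \<longleftrightarrow>
      0 \<le> p * q \<and> E / 4 < m (wucell K j) \<or> m (wvcell K j) \<le> E / 4"
    using assms(1-4) by (auto simp: cut_u_def)
  have ag: "bval s (abs_gt (disp_a K j) (tol K d)) \<longleftrightarrow> E < \<bar>p\<bar>"
    using assms(1-4) by (simp add: bval_abs_gt)
  have pa: "bval s (RLess (RConst 0) (disp_a K j)) \<longleftrightarrow> 0 < p"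
    "bval s (RLess (RConst 0) (disp_b K j)) \<longleftrightarrow> 0 < q"
    using assms(1-4) by simp_all
  have sm: "fst s = n" "snd s = m" using assms(1) by simp_all
  show ?thesis
    unfolding cut_def Let_def run.simps cu ag pa run_raise[OF ne(1)] run_lower[OF ne(1)]
      run_raise[OF ne(2)] run_lower[OF ne(2)] sm assms(5,6)
    by simp
qed

section \<open>The oracle padded to an even dimension\<close>

locale nonexp_oracle =
  fixes k h :: nat and f :: "vec \<Rightarrow> vec" and \<epsilon> :: real
  assumes k: "1 \<le> k" "k \<le> 2 * h"
    and nonexp: "nonexpansive k f"
    and eps: "0 < \<epsilon>" "\<epsilon> \<le> 1"
begin

abbreviation K :: nat where "K \<equiv> 2 * h"

abbreviation c :: real where "c \<equiv> 1 - \<epsilon> / 2"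

text \<open>The padding coordinate of the image is constantly 0, which preserves nonexpansiveness
  and agrees with the memory cell that no query writes.\<close>

definition F :: "vec \<Rightarrow> vec" where
  "F x i = (if i < k then f (restrict x {..<k}) i else 0)"

text \<open>Unlike \<open>cube\<close>, this does not require extensionality, so the whole real
  memory can serve as a point.\<close>

definition in_box :: "vec \<Rightarrow> bool" where
  "in_box x \<longleftrightarrow> (\<forall>i<K. 0 \<le> x i \<and> x i \<le> 1)"

lemma in_box_cube: "in_box x \<Longrightarrow> restrict x {..<k} \<in> cube k"
  using k by (auto simp: in_box_def cube_def)

lemma F_range:
  assumes "in_box x"
  shows "0 \<le> F x i \<and> F x i \<le> 1"
proof -
  have "f (restrict x {..<k}) \<in> cube k"
    using nonexp in_box_cube[OF assms] by (auto simp: nonexpansive_def)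
  then show ?thesis by (auto simp: F_def cube_def PiE_iff)
qed

lemma F_nonexp:
  assumes "in_box x" "in_box y" "\<And>i. i < K \<Longrightarrow> \<bar>x i - y i\<bar> \<le> D"
  shows "\<bar>F x i - F y i\<bar> \<le> D"
proof (cases "i < k")
  case True
  let ?x = "restrict x {..<k}" and ?y = "restrict y {..<k}"
  have "\<bar>f ?x i - f ?y i\<bar> \<le> linf_norm k (\<lambda>i. f ?x i - f ?y i)"
    unfolding linf_norm_def using True by (intro Max_ge) auto
  also have "\<dots> \<le> linf_norm k (\<lambda>i. ?x i - ?y i)"
    using nonexp in_box_cube assms(1,2) unfolding nonexpansive_def by blast
  also have "\<dots> \<le> D"
    unfolding linf_norm_def using True assms(3) k by (subst Max_le_iff) auto
  finally show ?thesis using True by (simp add: F_def)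
next
  case False
  have "0 \<le> D" using assms(3)[of 0] k by simp
  with False show ?thesis by (simp add: F_def)
qed

lemma c_bounds: "0 < c" "c < 1"
  using eps by auto

lemma scaled_F_range: "in_box x \<Longrightarrow> 0 \<le> c * F x i \<and> c * F x i \<le> 1"
  using F_range[of x i] c_bounds by (auto intro: mult_le_one)

text \<open>Picard iterates suffice here; an exact fixed point would need completeness.\<close>

lemma almost_fixed:
  assumes "in_box x0" "0 < \<tau>" "n \<le> K"
  obtains x where "in_box x" "\<And>i. n \<le> i \<Longrightarrow> x i = x0 i" "\<And>i. i < n \<Longrightarrow> \<bar>c * F x i - x i\<bar> \<le> \<tau>"
proof -
  \<comment> \<open>Only the first \<open>n\<close> coordinates are iterated; the others stay frozen
    at \<open>x0\<close>.\<close>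
  define G where "G x = (\<lambda>i. if i < n then c * F x i else x i)" for x :: vec
  define X where "X r = (G ^^ r) x0" for r
  have step: "X (Suc r) = G (X r)" for r by (simp add: X_def)
  have box: "in_box (X r)" for r
  proof (induction r)
    case 0
    then show ?case using assms by (simp add: X_def)
  next
    case (Suc r)
    then show ?case using scaled_F_range[OF Suc.IH] by (auto simp: in_box_def G_def X_def)
  qed
  have outer: "n \<le> i \<Longrightarrow> X r i = x0 i" for r i
    by (induction r) (auto simp: X_def G_def)
  \<comment> \<open>The first two iterates lie in the unit box, hence differ by at most 1, and each
    further step gains a factor \<open>c\<close>.\<close>
  have close: "\<bar>X (Suc r) i - X r i\<bar> \<le> c ^ r" if "i < K" for r i
    using that
  proof (induction r arbitrary: i)
    case 0
    then show ?case using box[of 0] box[of "Suc 0"] unfolding in_box_def by force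
  next
    case (Suc r)
    show ?case
    proof (cases "i < n")
      case True
      have "\<bar>F (X (Suc r)) i - F (X r) i\<bar> \<le> c ^ r"
        using Suc.IH by (intro F_nonexp box)
      then have "c * \<bar>F (X (Suc r)) i - F (X r) i\<bar> \<le> c ^ Suc r"
        using c_bounds by simp
      also have "c * \<bar>F (X (Suc r)) i - F (X r) i\<bar> = \<bar>c * F (X (Suc r)) i - c * F (X r) i\<bar>"
        using c_bounds by (simp add: abs_mult flip: right_diff_distrib)
      also have "\<dots> = \<bar>X (Suc (Suc r)) i - X (Suc r) i\<bar>"
        using True by (simp add: step[of "Suc r"] step[of r] G_def)
      finally show ?thesis .
    next
      case False
      then show ?thesis using outer[of i "Suc (Suc r)"] outer[of i "Suc r"] c_bounds by simp
    qed
  qed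
  obtain r where r: "c ^ r < \<tau>"
    using real_arch_pow_inv[OF assms(2) c_bounds(2)] by blast
  show ?thesis
  proof (rule that)
    show "\<bar>c * F (X r) i - X r i\<bar> \<le> \<tau>" if i: "i < n" for i
      using close[of i r] r i assms(3) by (simp add: step G_def)
  qed (use box outer in auto)
qed

section \<open>Memory invariants and correctness of the recursion\<close>

definition keep :: "nat \<Rightarrow> nat set" where
  "keep j = {2 * j..<K} \<union> {K + k..2 * K} \<union> {2 * K + 1 + 4 * j..}"

definition solved :: "nat \<Rightarrow> nat \<Rightarrow> (nat \<Rightarrow> real) \<Rightarrow> bool" where
  "solved j d m \<longleftrightarrow> in_box m \<and> (\<forall>i<K. m (K + i) = F m i) \<and>
     (\<forall>i<2 * j. \<bar>c * F m i - m i\<bar> \<le> tolv \<epsilon> d)"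

definition centred :: "nat \<Rightarrow> (nat \<Rightarrow> real) \<Rightarrow> bool" where
  "centred j m \<longleftrightarrow> m (2 * j) = clamp01 ((m (ucell K j) + m (vcell K j)) / 2) \<and>
     m (2 * j + 1) = clamp01 ((m (ucell K j) - m (vcell K j)) / 2)"

text \<open>The exponents \<open>a\<close> and \<open>b\<close> count the halvings already made, and
  \<open>n\<close> is the number still available: the potential for
  \<open>exec_while_bound\<close>.\<close>

definition enclosed :: "nat \<Rightarrow> nat \<Rightarrow> vec \<Rightarrow> nat \<Rightarrow> (nat \<Rightarrow> real) \<Rightarrow> bool" where
  "enclosed R j x n m \<longleftrightarrow>
     \<bar>x (2 * j) + x (2 * j + 1) - m (ucell K j)\<bar> \<le> m (wucell K j) \<and>
     \<bar>x (2 * j) - x (2 * j + 1) - m (vcell K j)\<bar> \<le> m (wvcell K j) \<and>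
     (\<exists>a b. m (wucell K j) = 1 / 2 ^ a \<and> m (wvcell K j) = 1 / 2 ^ b \<and>
        a \<le> R \<and> b \<le> R \<and> a + b + n = 2 * R)"

lemma tolv_pos: "0 < tolv \<epsilon> d"
  using eps by (simp add: tolv_def)

lemma tolv_antimono: "d \<le> d' \<Longrightarrow> tolv \<epsilon> d' \<le> tolv \<epsilon> d"
  unfolding tolv_def using eps by (intro mult_left_mono power_decreasing) auto

text \<open>By \<open>max_coordinate\<close> the largest component of the way to \<open>x\<close> is
  an outer one and agrees in sign with its displacement; \<open>half_plane\<close> turns this into
  the side on which \<open>x\<close> lies. The point \<open>x\<close> is only almost fixed, and its
  defect is absorbed by the slack \<open>\<tau>\<close>.\<close>

lemma cut_enclosed:
  assumes j: "j < h" and m: "solved j (Suc d) m" "centred j m" "m (2 * K) = \<epsilon>"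
    and x: "in_box x" "\<And>i. 2 * j + 2 \<le> i \<Longrightarrow> i < K \<Longrightarrow> x i = m i"
      "\<And>i. i < 2 * j + 2 \<Longrightarrow> \<bar>c * F x i - x i\<bar> \<le> \<epsilon> / 2 * tolv \<epsilon> d / 8"
    and enc: "enclosed R j x n m" and far: "bval (l, m) (far K j d)"
    and R: "4 / 2 ^ R \<le> tolv \<epsilon> d"
  obtains n' m' where "n = Suc n'" "run (cut K j d) (l, m) = (l, m')" "enclosed R j x n' m'"
    "\<And>i. i \<notin> {ucell K j, vcell K j, wucell K j, wvcell K j} \<Longrightarrow> m' i = m i"
proof -
  define E where "E = tolv \<epsilon> d"
  define \<tau> where "\<tau> = \<epsilon> / 2 * E / 8"
  define u v where "u = m (ucell K j)" and "v = m (vcell K j)"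
  define wu wv where "wu = m (wucell K j)" and "wv = m (wvcell K j)"
  define p q where "p = rval (l, m) (disp_a K j)" and "q = rval (l, m) (disp_b K j)"
  define xa xb where "xa = x (2 * j)" and "xb = x (2 * j + 1)"
  \<comment> \<open>The current point before clamping; all distances and displacements below refer
    to it.\<close>
  define y where "y i = (if i = 2 * j then (u + v) / 2 else if i = 2 * j + 1 then (u - v) / 2
                         else m i)" for i
  define z where "z i = x i - y i" for i
  define D where "D i = c * F m i - y i" for i
  have E: "0 < E" using tolv_pos by (simp add: E_def)
  have \<tau>: "0 \<le> \<tau>" "\<tau> \<le> E / 8"
    using E eps by (simp_all add: \<tau>_def mult_left_le_one_le)
  have img: "m (K + i) = F m i" if "i < K" for i using m that by (simp add: solved_def)
  have box: "in_box m" using m by (simp add: solved_def)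
  have p: "p = D (2 * j)" and q: "q = D (2 * j + 1)"
    using j img[of "2 * j"] img[of "2 * j + 1"] m(3)
    by (simp_all add: p_def q_def D_def y_def disp_a_def disp_b_def scaled_image_def
        centre_a_def centre_b_def u_def v_def)
  have tol: "rval (l, m) (tol K d) = E" using m(3) by (simp add: rval_tol E_def)
  have far': "E < \<bar>p\<bar> \<or> E < \<bar>q\<bar>"
    using far tol by (simp add: far_def bval_abs_gt p_def q_def)
  define M where "M = Max ((\<lambda>i. \<bar>z i\<bar>) ` {..<2 * j + 2})"
  have M_ge: "\<bar>z i\<bar> \<le> M" if "i < 2 * j + 2" for i
    unfolding M_def using that by (intro Max_ge) auto
  have "M \<in> (\<lambda>i. \<bar>z i\<bar>) ` {..<2 * j + 2}"
    unfolding M_def by (intro Max_in) auto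
  then obtain i0 where i0: "i0 < 2 * j + 2" "\<bar>z i0\<bar> = M" by auto
  have M0: "0 \<le> M" using i0 by linarith
  \<comment> \<open>Since \<open>x\<close> lies in the box, the clamped point is no farther from it
    than \<open>y\<close>. Coordinates from \<open>2 * j + 2\<close> on agree with \<open>x\<close>,
    so \<open>M\<close> may ignore them.\<close>
  have xm: "\<bar>x i - m i\<bar> \<le> M" if "i < K" for i
  proof -
    consider "i < 2 * j" | "i = 2 * j" | "i = 2 * j + 1" | "2 * j + 2 \<le> i" by linarith
    then show ?thesis
    proof cases
      case 1
      then show ?thesis using M_ge[of i] by (simp add: z_def y_def)
    next
      case 2
      then have "\<bar>x i - m i\<bar> \<le> \<bar>z i\<bar>"
        using m(2) x(1) that clamp01_closer[of "x i" "(u + v) / 2"]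
        by (simp add: centred_def in_box_def z_def y_def u_def v_def)
      then show ?thesis using M_ge[of i] 2 by simp
    next
      case 3
      then have "\<bar>x i - m i\<bar> \<le> \<bar>z i\<bar>"
        using m(2) x(1) that clamp01_closer[of "x i" "(u - v) / 2"]
        by (simp add: centred_def in_box_def z_def y_def u_def v_def)
      then show ?thesis using M_ge[of i] 3 by simp
    next
      case 4
      then show ?thesis using x(2)[of i] that M0 by simp
    qed
  qed
  have zD: "\<bar>z i - D i\<bar> \<le> (1 - \<epsilon> / 2) * M + \<tau>" if "i < 2 * j + 2" for i
  proof -
    have "\<bar>c * F x i - c * F m i\<bar> = c * \<bar>F x i - F m i\<bar>"
      using c_bounds by (simp add: abs_mult flip: right_diff_distrib)
    also have "\<dots> \<le> c * M"
      using F_nonexp[OF x(1) box xm, of i] c_bounds by (intro mult_left_mono) auto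
    finally have "\<bar>c * F x i - c * F m i\<bar> \<le> c * M" .
    moreover have "\<bar>c * F x i - x i\<bar> \<le> \<tau>" using x(3)[OF that] by (simp add: \<tau>_def E_def)
    moreover have "z i - D i = x i - c * F m i" by (simp add: z_def D_def)
    ultimately show ?thesis by linarith
  qed
  \<comment> \<open>The bound is exactly the tolerance of the next inner level.\<close>
  have small: "\<bar>D i\<bar> \<le> \<epsilon> / 2 * E / 4" if "i < 2 * j" for i
    using m(1) that by (simp add: solved_def D_def y_def E_def tolv_def algebra_simps)
  have maxc: "(i0 = 2 * j \<or> i0 = 2 * j + 1) \<and> 0 < D i0 * z i0 \<and> E - \<tau> < 2 * M"
  proof -
    have *: "(i0 = 2 * j \<or> i0 = 2 * j + 1) \<and> 0 < D i0 * z i0 \<and> E - \<tau> < 2 * M"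
      if "l' < 2 * j + 2" "E < \<bar>D l'\<bar>" for l'
      using max_coordinate[of "\<epsilon> / 2" E \<tau> "2 * j" z M i0 D l'] eps E \<tau> M_ge i0 zD small that
      by (simp add: \<tau>_def)
    from far' *[of "2 * j"] *[of "2 * j + 1"] show ?thesis unfolding p q by auto
  qed
  define za zb where "za = z (2 * j)" and "zb = z (2 * j + 1)"
  have zsum: "za + zb = xa + xb - u" "za - zb = xa - xb - v"
    by (simp_all add: za_def zb_def z_def y_def xa_def xb_def field_simps)
  have encu: "\<bar>za + zb\<bar> \<le> wu" and encv: "\<bar>za - zb\<bar> \<le> wv"
    using enc unfolding zsum by (simp_all add: enclosed_def xa_def xb_def u_def v_def wu_def wv_def)
  obtain a b where ab: "wu = 1 / 2 ^ a" "wv = 1 / 2 ^ b" "a \<le> R" "b \<le> R" "a + b + n = 2 * R"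
    using enc by (auto simp: enclosed_def wu_def wv_def)
  have M\<tau>: "(1 - \<epsilon> / 2) * M + \<tau> \<le> M + \<tau>"
    using M0 eps by (simp add: mult_left_le_one_le)
  have hp_prems: "\<bar>za\<bar> \<le> M" "\<bar>zb\<bar> \<le> M" "\<bar>za - p\<bar> \<le> M + \<tau>" "\<bar>zb - q\<bar> \<le> M + \<tau>"
    "\<bar>za\<bar> = M \<and> 0 < p * za \<or> \<bar>zb\<bar> = M \<and> 0 < q * zb"
    using M_ge[of "2 * j"] M_ge[of "2 * j + 1"] zD[of "2 * j"] zD[of "2 * j + 1"] M\<tau> maxc i0(2)
    unfolding za_def zb_def p q by auto
  note hp = half_plane[OF hp_prems(1-4) \<tau>(2) E hp_prems(5)]
  \<comment> \<open>Otherwise both outer components are at most \<open>E / 4\<close> in modulus,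
    hence so is \<open>M\<close>, contradicting \<open>E - \<tau> < 2 * M\<close>. So some side can
    still be halved.\<close>
  have not_both: "\<not> (wu \<le> E / 4 \<and> wv \<le> E / 4)"
    using encu encv hp_prems(5) maxc \<tau> E by linarith
  \<comment> \<open>The choice of \<open>R\<close> gives \<open>1 / 2 ^ R \<le> E / 4\<close>, so a
    side still wider than that has a halving left.\<close>
  have thin: "e < R" if "E / 4 < 1 / 2 ^ e" "e \<le> R" for e
  proof (rule ccontr)
    assume "\<not> e < R"
    with that R show False by (simp add: E_def)
  qed
  define su where "su = (if E < \<bar>p\<bar> then 0 < p else 0 < q)"
  define sv where "sv = (if E < \<bar>p\<bar> then 0 < p else \<not> 0 < q)"
  let ?cu = "0 \<le> p * q \<and> E / 4 < wu \<or> wv \<le> E / 4"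
  define m' where "m' = (if ?cu
     then m(wucell K j := wu / 2, ucell K j := (if su then u + wu / 2 else u - wu / 2))
     else m(wvcell K j := wv / 2, vcell K j := (if sv then v + wv / 2 else v - wv / 2)))"
  have run: "run (cut K j d) (l, m) = (l, m')"
    using run_cut[OF refl p_def q_def tol[symmetric] su_def sv_def]
    unfolding m'_def u_def v_def wu_def wv_def .
  have same: "m' i = m i" if "i \<notin> {ucell K j, vcell K j, wucell K j, wvcell K j}" for i
    using that by (auto simp: m'_def)
  have "\<exists>n'. n = Suc n' \<and> enclosed R j x n' m'"
  proof (cases ?cu)
    case True
    then have "E / 4 < wu" using not_both by linarith
    then have "a < R" using thin[of a] ab by simp
    then obtain n' where n': "n = Suc n'" "Suc a + b + n' = 2 * R"
      using ab(4,5) by (cases n) auto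
    \<comment> \<open>If the signs disagree, this branch was taken because the v-side is thin, the
      other alternative in \<open>half_plane\<close>.\<close>
    have cond: "0 \<le> p * q \<or> \<bar>za - zb\<bar> \<le> E / 4" using True encv by linarith
    have "u \<le> xa + xb" if su
      using hp(1)[OF cond] hp(2)[OF cond] far' that E zsum(1)
      by (auto simp: su_def zero_le_mult_iff split: if_splits)
    moreover have "xa + xb \<le> u" if "\<not> su"
      using hp(1)[OF cond] hp(2)[OF cond] far' that E zsum(1)
      by (auto simp: su_def zero_le_mult_iff split: if_splits)
    ultimately have encu': "\<bar>xa + xb - (if su then u + wu / 2 else u - wu / 2)\<bar> \<le> wu / 2"
      using encu zsum(1) by (intro halve_interval) auto
    have "wu / 2 = 1 / 2 ^ Suc a" using ab by simp
    moreover have cells: "m' (ucell K j) = (if su then u + wu / 2 else u - wu / 2)"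
      "m' (vcell K j) = v" "m' (wucell K j) = wu / 2" "m' (wvcell K j) = wv"
      unfolding m'_def if_P[OF True] by (simp_all add: cell_defs v_def wv_def)
    moreover have "Suc a \<le> R" using \<open>a < R\<close> by simp
    ultimately have "enclosed R j x n' m'"
      unfolding enclosed_def xa_def[symmetric] xb_def[symmetric] cells
      using n'(2) ab(2,4) encv encu' unfolding zsum
      by (intro conjI exI[of _ "Suc a"] exI[of _ b]) assumption+
    then show ?thesis using n' by blast
  next
    case False
    then have "E / 4 < wv" by linarith
    then have "b < R" using thin[of b] ab by simp
    then obtain n' where n': "n = Suc n'" "a + Suc b + n' = 2 * R"
      using ab(3,5) by (cases n) auto
    have cond: "p * q \<le> 0 \<or> \<bar>za + zb\<bar> \<le> E / 4" using False encu by linarith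
    have "v \<le> xa - xb" if sv
      using hp(3)[OF cond] hp(4)[OF cond] far' that E zsum(2)
      by (auto simp: sv_def zero_le_mult_iff mult_le_0_iff split: if_splits)
    moreover have "xa - xb \<le> v" if "\<not> sv"
      using hp(3)[OF cond] hp(4)[OF cond] far' that E zsum(2)
      by (auto simp: sv_def zero_le_mult_iff mult_le_0_iff split: if_splits)
    ultimately have encv': "\<bar>xa - xb - (if sv then v + wv / 2 else v - wv / 2)\<bar> \<le> wv / 2"
      using encv zsum(2) by (intro halve_interval) auto
    have "wv / 2 = 1 / 2 ^ Suc b" using ab by simp
    moreover have cells: "m' (vcell K j) = (if sv then v + wv / 2 else v - wv / 2)"
      "m' (ucell K j) = u" "m' (wvcell K j) = wv / 2" "m' (wucell K j) = wu"
      unfolding m'_def if_not_P[OF False] by (simp_all add: cell_defs u_def wu_def)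
    moreover have "Suc b \<le> R" using \<open>b < R\<close> by simp
    ultimately have "enclosed R j x n' m'"
      unfolding enclosed_def xa_def[symmetric] xb_def[symmetric] cells
      using n'(2) ab(1,3) encu encv' unfolding zsum
      by (intro conjI exI[of _ a] exI[of _ "Suc b"]) assumption+
    then show ?thesis using n' by blast
  qed
  then show ?thesis using that run same by blast
qed

text \<open>The sum \<open>d + j\<close> is constant along the recursion, so one \<open>R\<close>,
  chosen for the smallest tolerance, serves all levels.\<close>

lemma level_correct:
  assumes "j \<le> h" "snd s (2 * K) = \<epsilon>"
    "\<And>i. 2 * j \<le> i \<Longrightarrow> i < K \<Longrightarrow> 0 \<le> snd s i \<and> snd s i \<le> 1"
    "\<And>i. K + k \<le> i \<Longrightarrow> i < 2 * K \<Longrightarrow> snd s i = 0"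
    "4 / 2 ^ R \<le> tolv \<epsilon> (d + j)"
  shows "\<exists>t s'. exec k f (level K j d) s t s' \<and> t \<le> level_time K R j d \<and> solved j d (snd s') \<and>
           (\<forall>i\<in>keep j. snd s' i = snd s i)"
  using assms
proof (induction j arbitrary: d s)
  case 0
  define m where "m = snd s"
  have box: "in_box m" using 0 by (auto simp: in_box_def m_def)
  have rd: "read_vec k m 0 = restrict m {..<k}" by (auto simp: read_vec_def)
  define m' where "m' = write_vec k K (f (restrict m {..<k})) m"
  have ex: "exec k f (level K 0 d) s 3 (fst s, m')"
    using exec.Query[of k s "NConst 0" f "NConst K"] in_box_cube[OF box] rd
    by (simp add: m_def m'_def numeral_3_eq_3)
  have low: "m' i = m i" if "i < K" for i using that by (simp add: m'_def write_vec_def)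
  have restr: "restrict m' {..<k} = restrict m {..<k}"
    using low k by (auto simp: restrict_def)
  have "m' (K + i) = F m' i" if "i < K" for i
  proof (cases "i < k")
    case True
    then show ?thesis by (simp add: F_def restr) (simp add: m'_def write_vec_def)
  next
    case False
    then show ?thesis using 0(4)[of "K + i"] that
      by (simp add: F_def m'_def write_vec_def m_def)
  qed
  then have "solved 0 d m'" using box low by (auto simp: solved_def in_box_def)
  moreover have "m' i = m i" if "i \<in> keep 0" for i
    using that k by (auto simp: keep_def m'_def write_vec_def)
  ultimately show ?case using ex
    by (intro exI[of _ 3] exI[of _ "(fst s, m')"]) (auto simp: m_def)
next
  case (Suc j)
  have j: "j < h" "2 * j + 1 < K" using Suc.prems(1) by auto
  define m0 where "m0 = snd s"
  let ?U = "{ucell K j, vcell K j, wucell K j, wvcell K j}"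
  \<comment> \<open>\<open>keep\<close> is a frame condition: outer coordinates, image padding,
    accuracy and the search regions of outer levels. The region of level \<open>j\<close> survives
    the inner call but may be changed by the current one.\<close>
  have U_keep: "?U \<subseteq> keep j" "?U \<inter> keep (Suc j) = {}"
    using j k by (auto simp: keep_def cell_defs)
  have ab_keep: "2 * j \<in> keep j" "2 * j + 1 \<in> keep j"
    "2 * j \<notin> keep (Suc j)" "2 * j + 1 \<notin> keep (Suc j)"
    using j k by (auto simp: keep_def)
  have U_ab: "?U \<inter> {2 * j, 2 * j + 1} = {}" using j by (auto simp: cell_defs)
  have keep_mono: "keep (Suc j) \<subseteq> keep j" by (auto simp: keep_def)
  have R: "4 / 2 ^ R \<le> tolv \<epsilon> (Suc d + j)" "4 / 2 ^ R \<le> tolv \<epsilon> d"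
    using Suc.prems(5) tolv_antimono[of d "d + Suc j"] by auto
  \<comment> \<open>Only the coordinates from \<open>2 * j + 2\<close> on are inherited by the
    target \<open>x\<close>. The loop never changes them, so one \<open>x\<close> serves for all its
    iterations.\<close>
  define x0 where "x0 i = (if i < 2 * j + 2 then 0 else m0 i)" for i
  have "in_box x0" using Suc.prems(3) by (auto simp: in_box_def x0_def m0_def)
  moreover have "0 < \<epsilon> / 2 * tolv \<epsilon> d / 8" using eps tolv_pos by simp
  moreover have "2 * j + 2 \<le> K" using j by simp
  ultimately obtain x where x: "in_box x" "\<And>i. 2 * j + 2 \<le> i \<Longrightarrow> x i = x0 i"
      "\<And>i. i < 2 * j + 2 \<Longrightarrow> \<bar>c * F x i - x i\<bar> \<le> \<epsilon> / 2 * tolv \<epsilon> d / 8"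
    using almost_fixed by blast
  define fixd where "fixd m \<longleftrightarrow> (\<forall>i\<in>keep (Suc j). m i = m0 i)" for m :: "nat \<Rightarrow> real"
  define I where "I n s' \<longleftrightarrow> solved j (Suc d) (snd s') \<and> centred j (snd s') \<and>
      enclosed R j x n (snd s') \<and> fixd (snd s')" for n and s' :: state
  have eps_cell: "m (2 * K) = \<epsilon>" if "fixd m" for m
    using that Suc.prems(2) k by (auto simp: fixd_def keep_def m0_def)
  have inner: "\<exists>t s'. exec k f (level K j (Suc d)) s1 t s' \<and> t \<le> level_time K R j (Suc d) \<and> I n s'"
    if "fixd (snd s1)" "centred j (snd s1)" "enclosed R j x n (snd s1)" for s1 n
  proof -
    have "\<exists>t s'. exec k f (level K j (Suc d)) s1 t s' \<and> t \<le> level_time K R j (Suc d) \<and>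
        solved j (Suc d) (snd s') \<and> (\<forall>i\<in>keep j. snd s' i = snd s1 i)"
    proof (rule Suc.IH)
      show "j \<le> h" using j by simp
      show "snd s1 (2 * K) = \<epsilon>" using eps_cell that(1) .
      show "0 \<le> snd s1 i \<and> snd s1 i \<le> 1" if i: "2 * j \<le> i" "i < K" for i
      proof (cases "2 * Suc j \<le> i")
        case True
        then have "snd s1 i = m0 i" using i \<open>fixd (snd s1)\<close> by (auto simp: fixd_def keep_def)
        then show ?thesis using Suc.prems(3)[OF True i(2)] by (simp add: m0_def)
      next
        case False
        then have "i = 2 * j \<or> i = 2 * j + 1" using i by presburger
        then show ?thesis using \<open>centred j (snd s1)\<close> clamp01_range by (auto simp: centred_def)
      qed
      show "snd s1 i = 0" if i: "K + k \<le> i" "i < 2 * K" for i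
        using Suc.prems(4)[OF i] i \<open>fixd (snd s1)\<close> by (auto simp: fixd_def keep_def m0_def)
    qed (use R in auto)
    then obtain t s' where s': "exec k f (level K j (Suc d)) s1 t s'"
      "t \<le> level_time K R j (Suc d)" "solved j (Suc d) (snd s')"
      "\<And>i. i \<in> keep j \<Longrightarrow> snd s' i = snd s1 i" by blast
    have "I n s'"
      using s'(3,4) that U_keep(1) ab_keep keep_mono
      by (auto simp: I_def centred_def enclosed_def fixd_def)
    with s' show ?thesis by blast
  qed
  define s1 where "s1 = run (start K j) s"
  have s1: "snd s1 = m0(ucell K j := 1, vcell K j := 0, wucell K j := 1, wvcell K j := 1,
      2 * j := clamp01 (1 / 2), 2 * j + 1 := clamp01 (1 / 2))"
    by (simp add: s1_def run_start[OF j(2)] m0_def)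
  have "fixd (snd s1)"
    using U_keep(2) ab_keep unfolding fixd_def s1 by auto
  moreover have "centred j (snd s1)"
    using j unfolding centred_def s1 by (simp add: cell_defs)
  moreover have "enclosed R j x (2 * R) (snd s1)"
  proof -
    have u: "snd s1 (ucell K j) = 1" "snd s1 (vcell K j) = 0"
      "snd s1 (wucell K j) = 1" "snd s1 (wvcell K j) = 1"
      using j unfolding s1 by (simp_all add: cell_defs)
    have "0 \<le> x (2 * j)" "x (2 * j) \<le> 1" "0 \<le> x (2 * j + 1)" "x (2 * j + 1) \<le> 1"
      using x(1) j by (auto simp: in_box_def)
    then show ?thesis unfolding enclosed_def u
      by (intro conjI exI[of _ 0]) (simp_all add: abs_le_iff)
  qed
  ultimately obtain t2 s2 where s2: "exec k f (level K j (Suc d)) s1 t2 s2"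
    "t2 \<le> level_time K R j (Suc d)" "I (2 * R) s2"
    using inner by blast
  obtain t1 where t1: "t1 \<le> wcost (start K j)" "exec k f (start K j) s t1 s1"
    using exec_straight[OF straight_pieces(2)] unfolding s1_def by blast
  let ?body = "Seq (cut K j d) (Seq (place K j) (level K j (Suc d)))"
  let ?B = "wcost (cut K j d) + (wcost (place K j) + level_time K R j (Suc d))"
  have "\<exists>t s' n'. exec k f (While (far K j d) ?body) s2 t s' \<and>
      t \<le> Suc (2 * R) * (1 + bcost (far K j d) + ?B) \<and> \<not> bval s' (far K j d) \<and> I n' s'"
  proof (rule exec_while_bound[where I = I])
    fix n s3
    assume I: "I n s3" and far: "bval s3 (far K j d)"
    obtain l m where s3: "s3 = (l, m)" by (cases s3)
    have Im: "solved j (Suc d) m" "centred j m" "enclosed R j x n m" "fixd m"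
      using I by (auto simp: I_def s3)
    have outer: "x i = m i" if "2 * j + 2 \<le> i" "i < K" for i
      using x(2)[OF that(1)] that Im(4) by (auto simp: x0_def fixd_def keep_def)
    obtain n' m' where cut: "n = Suc n'" "run (cut K j d) (l, m) = (l, m')"
      "enclosed R j x n' m'" "\<And>i. i \<notin> ?U \<Longrightarrow> m' i = m i"
      using cut_enclosed[OF j(1) Im(1,2) eps_cell[OF Im(4)] x(1) outer x(3) Im(3)
          far[unfolded s3] R(2)] by blast
    define s4 where "s4 = run (place K j) (l, m')"
    have s4: "snd s4 = m'(2 * j := clamp01 ((m' (ucell K j) + m' (vcell K j)) / 2),
        2 * j + 1 := clamp01 ((m' (ucell K j) - m' (vcell K j)) / 2))"
      by (simp add: s4_def run_place[OF j(2)])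
    have U4: "snd s4 i = m' i" if "i \<in> ?U" for i
    proof -
      have "i \<noteq> 2 * j" "i \<noteq> 2 * j + 1" using U_ab that by blast+
      then show ?thesis unfolding s4 by simp
    qed
    have fx: "fixd (snd s4)"
      unfolding fixd_def
    proof
      fix i assume i: "i \<in> keep (Suc j)"
      then have "i \<notin> ?U" "i \<noteq> 2 * j" "i \<noteq> 2 * j + 1" using U_keep(2) ab_keep by blast+
      then show "snd s4 i = m0 i" using cut(4)[of i] Im(4) i unfolding s4 fixd_def by simp
    qed
    have ctr: "centred j (snd s4)"
      unfolding centred_def using U4[of "ucell K j"] U4[of "vcell K j"] by (simp add: s4)
    have enc: "enclosed R j x n' (snd s4)"
      using cut(3) U4 by (simp add: enclosed_def)
    obtain t5 s5 where s5: "exec k f (level K j (Suc d)) s4 t5 s5"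
      "t5 \<le> level_time K R j (Suc d)" "I n' s5"
      using inner[OF fx ctr enc] by blast
    obtain t3 where t3: "t3 \<le> wcost (cut K j d)" "exec k f (cut K j d) s3 t3 (l, m')"
      using exec_straight[OF straight_pieces(3), of K j d k f s3] unfolding s3 cut(2) by blast
    obtain t4 where t4: "t4 \<le> wcost (place K j)" "exec k f (place K j) (l, m') t4 s4"
      using exec_straight[OF straight_pieces(1)] unfolding s4_def by blast
    have "exec k f ?body s3 (t3 + (t4 + t5)) s5"
      using t3(2) t4(2) s5(1) by (intro exec.Seq)
    moreover have "t3 + (t4 + t5) \<le> ?B" using t3 t4 s5 by linarith
    ultimately show "\<exists>n' t s'. n = Suc n' \<and> exec k f ?body s3 t s' \<and> t \<le> ?B \<and> I n' s'"
      using cut(1) s5(3) by blast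
  qed (rule s2(3))
  then obtain t6 s6 n6 where s6: "exec k f (While (far K j d) ?body) s2 t6 s6"
    "t6 \<le> Suc (2 * R) * (1 + bcost (far K j d) + ?B)" "\<not> bval s6 (far K j d)" "I n6 s6"
    by blast
  have ex: "exec k f (level K (Suc j) d) s (t1 + (t2 + t6)) s6"
    using t1(2) s2(1) s6(1) unfolding level.simps by (intro exec.Seq)
  have time: "t1 + (t2 + t6) \<le> level_time K R (Suc j) d"
    using t1(1) s2(2) s6(2) unfolding level_time.simps by linarith
  define m where "m = snd s6"
  have Im: "solved j (Suc d) m" "centred j m" "fixd m" using s6(4) by (auto simp: I_def m_def)
  have box: "in_box m" and img: "\<And>i. i < K \<Longrightarrow> m (K + i) = F m i"
    using Im(1) by (auto simp: solved_def)
  have tol: "rval s6 (tol K d) = tolv \<epsilon> d"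
    using eps_cell[OF Im(3)] by (simp add: rval_tol m_def)
  have disp: "\<bar>c * F m (2 * j) - (m (ucell K j) + m (vcell K j)) / 2\<bar> \<le> tolv \<epsilon> d"
    "\<bar>c * F m (2 * j + 1) - (m (ucell K j) - m (vcell K j)) / 2\<bar> \<le> tolv \<epsilon> d"
    using s6(3) tol eps_cell[OF Im(3)] img[of "2 * j"] img[of "2 * j + 1"] j
    by (simp_all add: far_def bval_abs_gt disp_a_def disp_b_def scaled_image_def
        centre_a_def centre_b_def m_def not_less)
  \<comment> \<open>The exit test bounds displacements from the unclamped centre. The scaled image
    lies in the unit interval, so clamping cannot increase them.\<close>
  have "\<bar>c * F m i - m i\<bar> \<le> tolv \<epsilon> d" if "i < 2 * Suc j" for i
  proof -
    have "i < 2 * j \<or> i = 2 * j \<or> i = 2 * j + 1" using that by presburger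
    then consider "i < 2 * j" | "i = 2 * j" | "i = 2 * j + 1" by blast
    then show ?thesis
    proof cases
      case 1
      then show ?thesis using Im(1) tolv_antimono[of d "Suc d"] by (force simp: solved_def)
    next
      case 2
      then show ?thesis
        using disp(1) Im(2) scaled_F_range[OF box, of i]
          clamp01_closer[of "c * F m i" "(m (ucell K j) + m (vcell K j)) / 2"]
        by (simp add: centred_def)
    next
      case 3
      then show ?thesis
        using disp(2) Im(2) scaled_F_range[OF box, of i]
          clamp01_closer[of "c * F m i" "(m (ucell K j) - m (vcell K j)) / 2"]
        by (simp add: centred_def)
    qed
  qed
  then have "solved (Suc j) d m" using box img by (simp add: solved_def)
  moreover have "\<forall>i\<in>keep (Suc j). snd s6 i = snd s i"
    using Im(3) by (simp add: fixd_def m_def m0_def)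
  ultimately show ?case using ex time unfolding m_def by blast
qed

text \<open>Half of the accuracy is the tolerance of the outermost level, the other half pays for
  the factor \<open>1 - \<epsilon> / 2\<close>, since the image is at most 1.\<close>

lemma solves:
  assumes "4 / 2 ^ R \<le> tolv \<epsilon> h"
  shows "\<exists>t s. exec k f (Seq (assign (2 * K) (cell 0)) (level K h 0)) (init_state k \<epsilon>) t s \<and>
           t \<le> 4 + level_time K R h 0 \<and> eps_fixed_point k \<epsilon> f (result_vec k s)"
proof -
  let ?s = "run (assign (2 * K) (cell 0)) (init_state k \<epsilon>)"
  \<comment> \<open>The accuracy is copied first, because cell 0 also holds the first coordinate of
    the point.\<close>
  have 1: "exec k f (assign (2 * K) (cell 0)) (init_state k \<epsilon>) 4 ?s"
    using exec.RStore[of k f "NConst (2 * K)" "cell 0" "init_state k \<epsilon>"]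
    by (simp add: numeral_eq_Suc)
  obtain t s where s: "exec k f (level K h 0) ?s t s" "t \<le> level_time K R h 0"
    "solved h 0 (snd s)"
    using level_correct[of h ?s R 0] assms k by (auto simp: init_state_def)
  define m where "m = snd s"
  have box: "in_box m" and close: "\<And>i. i < K \<Longrightarrow> \<bar>c * F m i - m i\<bar> \<le> \<epsilon> / 2"
    using s(3) by (auto simp: solved_def m_def tolv_def)
  have res: "result_vec k s = restrict m {..<k}"
    by (auto simp: result_vec_def read_vec_def m_def)
  have "\<bar>f (restrict m {..<k}) i - restrict m {..<k} i\<bar> \<le> \<epsilon>" if i: "i < k" for i
  proof -
    have "c * F m i - m i = F m i - m i - \<epsilon> / 2 * F m i" by (simp add: algebra_simps)
    moreover have "0 \<le> \<epsilon> / 2 * F m i" using F_range[OF box, of i] eps by simp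
    ultimately have "\<bar>F m i - m i\<bar> \<le> \<bar>c * F m i - m i\<bar> + \<epsilon> / 2 * F m i" by linarith
    moreover have "\<epsilon> / 2 * F m i \<le> \<epsilon> / 2"
      using F_range[OF box, of i] eps by (intro mult_left_le) auto
    ultimately have "\<bar>F m i - m i\<bar> \<le> \<epsilon>" using close[of i] i k by linarith
    then show ?thesis using i by (simp add: F_def)
  qed
  then have "eps_fixed_point k \<epsilon> f (result_vec k s)"
    unfolding eps_fixed_point_def res linf_norm_def using in_box_cube[OF box] k
    by (subst Max_le_iff) (auto simp: lessThan_empty_iff)
  with exec.Seq[OF 1 s(1)] s(2) show ?thesis by (intro exI conjI) auto
qed

end

section \<open>Running time\<close>

text \<open>Each level multiplies the time by its number of iterations, which is in O(g); the second
  assumption absorbs the constant costs.\<close>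

lemma level_time_bigo:
  fixes R :: "real \<Rightarrow> nat"
  assumes "(\<lambda>\<epsilon>. real (R \<epsilon>)) \<in> O[G](g)" "(\<lambda>_. 1) \<in> O[G](g)"
  shows "(\<lambda>\<epsilon>. real (level_time K (R \<epsilon>) j d)) \<in> O[G](\<lambda>\<epsilon>. g \<epsilon> ^ j)"
proof (induction j arbitrary: d)
  case 0
  show ?case by simp
next
  case (Suc j)
  let ?T = "\<lambda>\<epsilon>. real (level_time K (R \<epsilon>) j (Suc d))"
  have const: "(\<lambda>_. a) \<in> O[G](g)" for a :: real
    using landau_o.big.mult[OF bigo_const[of a G] assms(2)] by simp
  have one: "(\<lambda>_. 1) \<in> O[G](\<lambda>\<epsilon>. g \<epsilon> ^ i)" for i
    using landau_o.big_power[OF assms(2), of i] by simp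
  have const': "(\<lambda>_. a) \<in> O[G](\<lambda>\<epsilon>. g \<epsilon> ^ i)" for a :: real and i
    using landau_o.big.mult[OF bigo_const[of a G] one[of i]] by simp
  have T: "?T \<in> O[G](\<lambda>\<epsilon>. g \<epsilon> ^ j)" by (rule Suc.IH)
  have T': "?T \<in> O[G](\<lambda>\<epsilon>. g \<epsilon> ^ Suc j)"
    using landau_o.big.mult[OF assms(2) T] by simp
  have "(\<lambda>\<epsilon>. 1 + 2 * real (R \<epsilon>)) \<in> O[G](g)"
    using assms const by (intro sum_in_bigo) auto
  from landau_o.big.mult[OF this sum_in_bigo(1)[OF const' T]]
  have "(\<lambda>\<epsilon>. (1 + 2 * real (R \<epsilon>)) * (real a + ?T \<epsilon>)) \<in> O[G](\<lambda>\<epsilon>. g \<epsilon> ^ Suc j)" for a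
    by simp
  from sum_in_bigo(1)[OF const' sum_in_bigo(1)[OF T' this]]
  have "(\<lambda>\<epsilon>. real b + (?T \<epsilon> + (1 + 2 * real (R \<epsilon>)) * (real a + ?T \<epsilon>))) \<in> O[G](\<lambda>\<epsilon>. g \<epsilon> ^ Suc j)"
    for a b .
  from this[of "wcost (start K j)"
      "1 + bcost (far K j d) + (wcost (cut K j d) + wcost (place K j))"]
  show ?case by (simp add: algebra_simps)
qed

text \<open>Chosen so that \<open>2 ^ fuel h \<epsilon>\<close> is at least
  \<open>4 * (8 / \<epsilon>) ^ Suc h\<close>, the final 2 supplying the factor 4. It occurs only in
  the analysis: the loops test displacements and compute no logarithm.\<close>

definition fuel :: "nat \<Rightarrow> real \<Rightarrow> nat" where
  "fuel h \<epsilon> = nat \<lceil>real (Suc h) * (log 2 (1 / \<epsilon>) + 3)\<rceil> + 2"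

lemma fuel_enough:
  assumes "0 < \<epsilon>" "\<epsilon> \<le> 1"
  shows "4 / 2 ^ fuel h \<epsilon> \<le> tolv \<epsilon> h"
proof -
  have "(8 / \<epsilon>) ^ Suc h = 2 powr (real (Suc h) * (log 2 (1 / \<epsilon>) + 3))"
  proof -
    have "2 powr (log 2 (1 / \<epsilon>) + 3) = 8 / \<epsilon>"
      using assms by (simp add: powr_add)
    then show ?thesis
      by (metis mult.commute powr_powr powr_realpow powr_gt_zero zero_neq_numeral)
  qed
  also have "\<dots> \<le> 2 powr real (nat \<lceil>real (Suc h) * (log 2 (1 / \<epsilon>) + 3)\<rceil>)"
    by (intro powr_mono real_nat_ceiling_ge) auto
  also have "\<dots> = 2 ^ nat \<lceil>real (Suc h) * (log 2 (1 / \<epsilon>) + 3)\<rceil>"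
    by (simp add: powr_realpow)
  finally have "4 * (8 / \<epsilon>) ^ Suc h \<le> 2 ^ fuel h \<epsilon>"
    by (simp add: fuel_def power_add)
  then have "4 / 2 ^ fuel h \<epsilon> \<le> 4 / (4 * (8 / \<epsilon>) ^ Suc h)"
    using assms by (intro divide_left_mono) auto
  also have "\<dots> = (\<epsilon> / 8) ^ Suc h"
    by (simp add: power_divide)
  also have "\<dots> \<le> tolv \<epsilon> h"
    unfolding tolv_def power_Suc using assms by (intro mult_right_mono) auto
  finally show ?thesis .
qed

lemma fuel_bigo: "(\<lambda>\<epsilon>. real (fuel h \<epsilon>)) \<in> O[at_right 0](\<lambda>\<epsilon>. log 2 (1 / \<epsilon>))"
proof (rule bigoI)
  show "\<forall>\<^sub>F \<epsilon> in at_right 0. norm (real (fuel h \<epsilon>)) \<le> (4 * real (Suc h) + 3) * norm (log 2 (1 / \<epsilon>))"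
    unfolding eventually_at_right_field
  \<comment> \<open>Below 1/2 the logarithm is at least 1 and dominates all additive
    constants.\<close>
  proof (intro exI[of _ "1 / 2"] conjI allI impI)
    fix \<epsilon> :: real
    assume \<epsilon>: "0 < \<epsilon>" "\<epsilon> < 1 / 2"
    have "log 2 2 \<le> log 2 (1 / \<epsilon>)" using \<epsilon> by (subst log_le_cancel_iff) (auto simp: field_simps)
    then have L: "1 \<le> log 2 (1 / \<epsilon>)" by simp
    have "real (fuel h \<epsilon>) \<le> real (Suc h) * (log 2 (1 / \<epsilon>) + 3) + 3"
      using L unfolding fuel_def by (simp add: of_nat_ceiling) linarith
    also have "\<dots> \<le> real (Suc h) * (4 * log 2 (1 / \<epsilon>)) + 3 * log 2 (1 / \<epsilon>)"
      using L by (intro add_mono mult_left_mono) auto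
    also have "\<dots> = (4 * real (Suc h) + 3) * log 2 (1 / \<epsilon>)" by (simp add: algebra_simps)
    finally show "norm (real (fuel h \<epsilon>)) \<le> (4 * real (Suc h) + 3) * norm (log 2 (1 / \<epsilon>))"
      using L by simp
  qed simp
qed

lemma one_bigo_log: "(\<lambda>_. 1) \<in> O[at_right 0](\<lambda>\<epsilon>. log 2 (1 / \<epsilon>))"
proof (rule bigoI[of _ 1])
  show "\<forall>\<^sub>F \<epsilon> in at_right 0. norm (1 :: real) \<le> 1 * norm (log 2 (1 / \<epsilon>))"
    unfolding eventually_at_right_field
  proof (intro exI[of _ "1 / 2"] conjI allI impI)
    fix \<epsilon> :: real
    assume \<epsilon>: "0 < \<epsilon>" "\<epsilon> < 1 / 2"
    have "log 2 2 \<le> log 2 (1 / \<epsilon>)" using \<epsilon> by (subst log_le_cancel_iff) (auto simp: field_simps)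
    then show "norm (1 :: real) \<le> 1 * norm (log 2 (1 / \<epsilon>))" by simp
  qed simp
qed

theorem theorem1p1:
  fixes k :: nat
  assumes "k \<ge> 1"
  shows "\<exists>(P :: com) (T :: real \<Rightarrow> nat).
           solves_NonExp_in_time k P T \<and>
           (\<lambda>\<epsilon>. real (T \<epsilon>)) \<in> O[at_right 0](\<lambda>\<epsilon>. log 2 (1 / \<epsilon>) ^ nat \<lceil>real k / 2\<rceil>)"
proof -
  define h where "h = nat \<lceil>real k / 2\<rceil>"
  have kh: "k \<le> 2 * h" unfolding h_def by linarith
  \<comment> \<open>The program depends on \<open>k\<close> alone; the accuracy is read from
    memory.\<close>
  define P where "P = Seq (assign (2 * (2 * h)) (cell 0)) (level (2 * h) h 0)"
  define T where "T \<epsilon> = 4 + level_time (2 * h) (fuel h \<epsilon>) h 0" for \<epsilon>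
  have "solves_NonExp_in_time k P T"
    unfolding solves_NonExp_in_time_def
  proof (intro ballI allI impI)
    fix \<epsilon> f
    assume \<epsilon>: "\<epsilon> \<in> {0<..1 :: real}" and f: "nonexpansive k f"
    interpret nonexp_oracle k h f \<epsilon>
      using assms kh \<epsilon> f by unfold_locales auto
    show "\<exists>t s. exec k f P (init_state k \<epsilon>) t s \<and> t \<le> T \<epsilon> \<and>
        eps_fixed_point k \<epsilon> f (result_vec k s)"
      unfolding P_def T_def using eps by (intro solves fuel_enough)
  qed
  moreover have "(\<lambda>\<epsilon>. real (T \<epsilon>)) \<in> O[at_right 0](\<lambda>\<epsilon>. log 2 (1 / \<epsilon>) ^ h)"
  proof -
    have "(\<lambda>_. 1 :: real) \<in> O[at_right 0](\<lambda>\<epsilon>. log 2 (1 / \<epsilon>) ^ h)"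
      using landau_o.big_power[OF one_bigo_log, of h] by simp
    then have "(\<lambda>_. 4 :: real) \<in> O[at_right 0](\<lambda>\<epsilon>. log 2 (1 / \<epsilon>) ^ h)"
      using landau_o.big.mult[OF bigo_const[of 4]] by fastforce
    from sum_in_bigo(1)[OF this level_time_bigo[OF fuel_bigo one_bigo_log]]
    show ?thesis by (simp add: T_def)
  qed
  ultimately show ?thesis unfolding h_def by blast
qed

end
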